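(* Let $0\le p<q$ be integers and let $z\in\mathbb Q\setminus\{0\}$. Then $1$ and the constants $$\sum_{k\ge0}\frac{z^k}{(k+1)^j\cdot k!^{\,q-p}},\qquad j=1,\dots,q,$$ are $\mathbb Q$-linearly independent. In particular, these constants are irrational.
   Context: "These constants are irrational" refers to the $q$ series for $j=1,\dots,q$. Here $k!^{\,q-p}=(k!)^{q-p}$. *)

theory Defs
  imports "HOL-Analysis.Analysis"
begin

text \<open>The reals as a vector space over the rationals.\<close>

definition rat_scale :: "rat \<Rightarrow> real \<Rightarrow> real" where
  "rat_scale r x = of_rat r * x"

global_interpretation rat_vs: vector_space rat_scale
  by unfold_locales (simp_all add: rat_scale_def of_rat_add of_rat_mult algebra_simps)

definition hyp_term :: "nat \<Rightarrow> nat \<Rightarrow> rat \<Rightarrow> nat \<Rightarrow> nat \<Rightarrow> real" where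
  "hyp_term p q z j k = of_rat z ^ k / (real (k + 1) ^ j * fact k ^ (q - p))"

definition hyp_const :: "nat \<Rightarrow> nat \<Rightarrow> rat \<Rightarrow> nat \<Rightarrow> real" where
  "hyp_const p q z j = (\<Sum>k. hyp_term p q z j k)"

text \<open>The series defining the constants do converge, so \<^const>\<open>suminf\<close> has its intended value.\<close>

lemma summable_hyp_term:
  assumes "p < q"
  shows "summable (hyp_term p q z j)"
proof (rule summable_comparison_test')
  show "summable (\<lambda>k. inverse (fact k) * \<bar>of_rat z :: real\<bar> ^ k)"
    by (rule summable_exp)
  fix k :: nat
  have "(1::real) * fact k \<le> real (k + 1) ^ j * fact k ^ (q - p)"
  proof (rule mult_mono)
    show "(1::real) \<le> real (k + 1) ^ j"
      by (rule one_le_power) simp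
    show "(fact k :: real) \<le> fact k ^ (q - p)"
      using assms by (intro self_le_power) simp_all
  qed simp_all
  then have "\<bar>of_rat z :: real\<bar> ^ k / (real (k + 1) ^ j * fact k ^ (q - p)) \<le> \<bar>of_rat z\<bar> ^ k / fact k"
    by (intro divide_left_mono) (simp_all add: mult_pos_pos)
  then show "norm (hyp_term p q z j k) \<le> inverse (fact k) * \<bar>of_rat z\<bar> ^ k"
    by (simp add: hyp_term_def abs_mult power_abs divide_inverse mult.commute del: of_nat_add of_nat_Suc)
qed

end

theory Submission
  imports Defs
begin

text \<open>
  Put \<open>d = q - p\<close>. Multiplied by \<open>z\<close>, a rational relation between the constants becomes
  \<open>\<gamma> + (\<Sum>n\<ge>1. A(n) z\<^sup>n / (n\<^sup>p n!\<^sup>d)) = 0\<close> with \<open>A\<close> a polynomial of degree less than \<open>q\<close>; after clearing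
  denominators \<open>A\<close> and \<open>\<gamma>\<close> are integral. Let \<open>T(N)\<close> be \<open>N!\<^sup>d z\<^bsup>-N\<^esup>\<close> times the \<open>N\<close>-th partial sum. As
  a partial sum is minus a tail, \<open>T\<close> grows at most geometrically. On the other hand, in
  \<open>T(N) = \<gamma> N!\<^sup>d z\<^bsup>-N\<^esup> + (\<Sum>m<N. (N!/(N-m)!)\<^sup>d A(N-m) (N-m)\<^bsup>-p\<^esup> z\<^bsup>-m\<^esup>)\<close> the summands with \<open>m < M\<close>,
  multiplied by \<open>(N choose M)\<^sup>p\<close>, are polynomials in \<open>N\<close> of degree less than \<open>Mq\<close>, and the other ones
  are multiples of \<open>M!\<^sup>d\<close> up to denominators of geometric growth. So for large \<open>M\<close> the difference
  of order \<open>Mq\<close> of \<open>(N choose M)\<^sup>p T(N)\<close> vanishes on \<open>M \<le> N \<le> 2M\<close>, and \<open>(N choose M)\<^sup>p T(N)\<close> is a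
  polynomial on a range long enough to turn the recurrence
  \<open>T(N + 1) = (N + 1)\<^sup>d T(N) / z + A(N + 1) / (N + 1)\<^sup>p\<close> into an identity of polynomials. Looking at
  its poles and its degree gives \<open>A = 0\<close>.
\<close>

section \<open>Common multiples of \<open>1, ..., n\<close> of geometric growth\<close>

text \<open>Vandermonde's identity splits \<open>n choose r\<close> along \<open>j\<close>. The
  summand \<open>l = 0\<close> vanishes as \<open>n - j < r\<close>; in the others absorption,
  \<open>l * (j choose l) = j * ((j - 1) choose (l - 1))\<close>, trades the divisor
  \<open>l\<close> of \<open>D\<close> for \<open>j\<close>.\<close>

lemma dvd_binomial_mult_common_multiple:
  fixes j n r D :: nat
  assumes "n - r < j" "j \<le> n" "r \<le> n" and D: "\<And>l. l \<in> {1..r} \<Longrightarrow> l dvd D"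
  shows "j dvd (n choose r) * D"
proof -
  have "n choose r = (\<Sum>l\<le>r. (j choose l) * ((n - j) choose (r - l)))"
    using vandermonde[of j "n - j" r] assms by simp
  then have "(n choose r) * D = (\<Sum>l\<le>r. (j choose l) * ((n - j) choose (r - l)) * D)"
    by (simp add: sum_distrib_right)
  moreover have "j dvd (j choose l) * ((n - j) choose (r - l)) * D" if "l \<le> r" for l
  proof (cases "l = 0")
    case True
    then show ?thesis using assms by (simp add: binomial_eq_0)
  next
    case False
    then obtain l' where l': "l = Suc l'" by (auto simp: gr0_conv_Suc)
    from assms obtain j' where j': "j = Suc j'" by (cases j) auto
    from D[of l] False that obtain e where "D = l * e" by auto
    moreover have "j * (j' choose l') = l * (j choose l)"
      unfolding l' j' by (metis Suc_times_binomial)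
    ultimately have "(j choose l) * D = j * ((j' choose l') * e)"
      by (metis mult.assoc mult.commute)
    then have "j dvd (j choose l) * D * ((n - j) choose (r - l))" by (metis dvd_mult2 dvd_triv_left)
    then show ?thesis by (simp only: ac_simps)
  qed
  ultimately show ?thesis by (auto intro: dvd_sum)
qed

text \<open>Halving: a common multiple for \<open>r\<close>, half of \<open>n\<close> rounded up,
  times \<open>n choose r\<close> serves for \<open>n\<close>. The base 8 leaves room for the
  rounding, since \<open>n + 3 * r \<le> 3 * n\<close> once \<open>n \<ge> 2\<close>.\<close>

lemma common_multiple_le_power:
  "\<exists>D::nat. 0 < D \<and> D \<le> 8 ^ n \<and> (\<forall>j\<in>{1..n}. j dvd D)"
proof (induction n rule: less_induct)
  case (less n)
  show ?case
  proof (cases "n \<le> 1")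
    case True
    then show ?thesis by (intro exI[of _ 1]) auto
  next
    case False
    define r where "r = n - n div 2"
    have r: "r < n" "n - r \<le> r" "r \<le> n" "n + 3 * r \<le> 3 * n" using False by (auto simp: r_def)
    from less[OF r(1)] obtain D where D: "0 < D" "D \<le> 8 ^ r" "\<forall>j\<in>{1..r}. j dvd D" by blast
    have "(n choose r) * D \<le> 2 ^ n * 8 ^ r" by (intro mult_mono binomial_le_pow2 D) simp_all
    also have "\<dots> = 2 ^ (n + 3 * r)" by (simp add: power_add power_mult)
    also have "\<dots> \<le> 2 ^ (3 * n)" using r by (intro power_increasing) simp_all
    finally have "(n choose r) * D \<le> 8 ^ n" by (simp add: power_mult)
    moreover have "j dvd (n choose r) * D" if "j \<in> {1..n}" for j
    proof (cases "j \<le> r")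
      case True
      then show ?thesis using D(3) that by auto
    next
      case False
      then show ?thesis using r that D(3)
        by (intro dvd_binomial_mult_common_multiple) auto
    qed
    ultimately show ?thesis using D(1) r(3) by (intro exI[of _ "(n choose r) * D"]) auto
  qed
qed

section \<open>Forward differences and interpolation\<close>

definition fdiff :: "(nat \<Rightarrow> real) \<Rightarrow> nat \<Rightarrow> real" where
  "fdiff f n = f (Suc n) - f n"

lemma fdiff_funpow_Suc:
  "(fdiff ^^ Suc k) f n = (fdiff ^^ k) f (Suc n) - (fdiff ^^ k) f n"
  by (simp add: fdiff_def)

lemma fdiff_funpow_diff:
  "(fdiff ^^ k) (\<lambda>n. f n - g n) n = (fdiff ^^ k) f n - (fdiff ^^ k) g n"
  by (induction k arbitrary: n) (simp_all only: fdiff_funpow_Suc, simp_all)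

lemma fdiff_funpow_Ints:
  assumes "\<And>i. i \<in> {n..n + k} \<Longrightarrow> c * f i \<in> \<int>"
  shows "c * (fdiff ^^ k) f n \<in> \<int>"
  using assms
proof (induction k arbitrary: n)
  case (Suc k)
  have "c * (fdiff ^^ k) f (Suc n) \<in> \<int>" "c * (fdiff ^^ k) f n \<in> \<int>"
    by (intro Suc.IH Suc.prems; simp)+
  then show ?case unfolding fdiff_funpow_Suc right_diff_distrib by (rule Ints_diff)
qed simp

lemma abs_fdiff_funpow_le:
  assumes "\<And>i. i \<in> {n..n + k} \<Longrightarrow> \<bar>f i\<bar> \<le> B"
  shows "\<bar>(fdiff ^^ k) f n\<bar> \<le> 2 ^ k * B"
  using assms
proof (induction k arbitrary: n)
  case (Suc k)
  have "\<bar>(fdiff ^^ k) f (Suc n)\<bar> \<le> 2 ^ k * B" "\<bar>(fdiff ^^ k) f n\<bar> \<le> 2 ^ k * B"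
    by (intro Suc.IH Suc.prems; simp)+
  then show ?case unfolding fdiff_funpow_Suc by simp
qed simp

text \<open>The shift preserves degree and leading coefficient, so the top terms cancel. The
  alternative \<open>= 0\<close> covers \<open>k = 0\<close>, as the zero polynomial has degree
  0.\<close>

lemma degree_pcompose_shift_diff_less:
  fixes P :: "real poly"
  assumes "degree P < Suc k" 
  shows "P \<circ>\<^sub>p [:1, 1:] - P = 0 \<or> degree (P \<circ>\<^sub>p [:1, 1:] - P) < k"
proof (cases "P \<circ>\<^sub>p [:1, 1:] - P = 0")
  case False
  have deg: "degree (P \<circ>\<^sub>p [:1, 1:]) = degree P" by (simp add: degree_pcompose)
  have "coeff (P \<circ>\<^sub>p [:1, 1:]) (degree P) = coeff P (degree P)"
    using lead_coeff_comp[of "[:1, 1:]" P] by (simp add: deg)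
  then have c: "coeff (P \<circ>\<^sub>p [:1, 1:] - P) (degree P) = 0" by simp
  have "degree (P \<circ>\<^sub>p [:1, 1:] - P) \<le> degree P" using deg by (intro degree_diff_le) simp_all
  moreover have "degree (P \<circ>\<^sub>p [:1, 1:] - P) \<noteq> degree P"
    using c False by (metis leading_coeff_0_iff)
  ultimately show ?thesis using assms by simp
qed simp

lemma fdiff_funpow_poly:
  fixes P :: "real poly"
  assumes "P = 0 \<or> degree P < k"
  shows "(fdiff ^^ k) (\<lambda>n. poly P (real n)) n = 0"
  using assms
proof (induction k arbitrary: P)
  case (Suc k)
  have "fdiff (\<lambda>n. poly P (real n)) = (\<lambda>n. poly (P \<circ>\<^sub>p [:1, 1:] - P) (real n))"
    by (simp add: fun_eq_iff fdiff_def poly_pcompose)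
  then have "(fdiff ^^ Suc k) (\<lambda>n. poly P (real n)) n
      = (fdiff ^^ k) (\<lambda>n. poly (P \<circ>\<^sub>p [:1, 1:] - P) (real n)) n"
    by (simp only: funpow_Suc_right comp_apply)
  also have "\<dots> = 0"
    using Suc.prems degree_pcompose_shift_diff_less[of P k] by (intro Suc.IH) auto
  finally show ?case .
qed simp

text \<open>The induction hypothesis applies to \<open>fdiff g\<close>, which vanishes at its first
  \<open>k\<close> points; so \<open>g\<close> is constant on the range, with value
  \<open>g M = 0\<close>.\<close>

lemma fdiff_funpow_zero_imp_zero:
  assumes "\<And>n. n \<in> {M..M + s} \<Longrightarrow> (fdiff ^^ k) g n = 0" "\<And>n. n \<in> {M..<M + k} \<Longrightarrow> g n = 0"
    and "n \<in> {M..M + s + k}"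
  shows "g n = 0"
  using assms
proof (induction k arbitrary: g n)
  case (Suc k)
  have D: "fdiff g i = 0" if "i \<in> {M..M + s + k}" for i
  proof (rule Suc.IH[OF _ _ that])
    show "(fdiff ^^ k) (fdiff g) i = 0" if "i \<in> {M..M + s}" for i
      using Suc.prems(1)[OF that] by (simp only: funpow_Suc_right comp_apply)
    show "fdiff g i = 0" if "i \<in> {M..<M + k}" for i
      using Suc.prems(2)[of i] Suc.prems(2)[of "Suc i"] that by (simp add: fdiff_def)
  qed
  from Suc.prems(3) have "M \<le> n" by simp
  then have "n \<le> M + s + Suc k \<longrightarrow> g n = 0"
  proof (induction n rule: dec_induct)
    case base
    then show ?case using Suc.prems(2)[of M] by simp
  next
    case (step i)
    then show ?case using D[of i] by (auto simp: fdiff_def)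
  qed
  then show ?case using Suc.prems(3) by simp
qed simp

lemma interpolation_exists:
  fixes f :: "nat \<Rightarrow> real"
  shows "\<exists>P. (P = 0 \<or> degree P < k) \<and> (\<forall>n\<in>{M..<M + k}. poly P (real n) = f n)"
proof (induction k)
  case (Suc k)
  then obtain P where P: "P = 0 \<or> degree P < k" "\<forall>n\<in>{M..<M + k}. poly P (real n) = f n" by blast
  define W where "W = (\<Prod>i\<in>{M..<M + k}. [:- real i, 1:])"
  have dW: "degree W = k" unfolding W_def by (subst degree_prod_eq_sum_degree) auto
  have W0: "poly W (real n) = 0" if "n \<in> {M..<M + k}" for n
    using that unfolding W_def poly_prod by (intro prod_zero) auto
  have W1: "poly W (real (M + k)) \<noteq> 0" unfolding W_def poly_prod by auto
  \<comment> \<open>Newton's step: \<open>W\<close> vanishes at the old nodes, so adding a multiple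
    of it corrects the value at the new node alone.\<close>
  define Q where "Q = P + smult ((f (M + k) - poly P (real (M + k))) / poly W (real (M + k))) W"
  have "degree Q \<le> k" unfolding Q_def using P(1) dW by (intro degree_add_le) auto
  moreover have "poly Q (real n) = f n" if "n \<in> {M..<M + Suc k}" for n
    using that P(2) W0[of n] W1 by (cases "n = M + k") (auto simp: Q_def)
  ultimately show ?case by (intro exI[of _ Q]) auto
qed simp

text \<open>Subtracting the interpolant at the first \<open>k\<close> points does not change the
  differences of order \<open>k\<close>, and \<open>fdiff_funpow_zero_imp_zero\<close> applies to
  what is left.\<close>

lemma fdiff_funpow_zero_imp_poly:
  assumes "\<And>n. n \<in> {M..M + s} \<Longrightarrow> (fdiff ^^ k) f n = 0"
  obtains P where "P = 0 \<or> degree P < k" "\<And>n. n \<in> {M..M + s + k} \<Longrightarrow> f n = poly P (real n)"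
proof -
  obtain P where P: "P = 0 \<or> degree P < k" "\<forall>n\<in>{M..<M + k}. poly P (real n) = f n"
    using interpolation_exists by blast
  have "f n - poly P (real n) = 0" if "n \<in> {M..M + s + k}" for n
    using fdiff_funpow_zero_imp_zero[OF _ _ that, where g = "\<lambda>n. f n - poly P (real n)"]
      fdiff_funpow_poly[OF P(1)] assms P(2)
    by (auto simp: fdiff_funpow_diff)
  then show thesis using that[OF P(1)] by simp
qed

section \<open>Falling factorials and the polynomial shift equation\<close>

definition ffact_poly :: "nat \<Rightarrow> real poly" where
  "ffact_poly M = (\<Prod>i<M. [:- real i, 1:])"

lemma degree_ffact_poly [simp]: "degree (ffact_poly M) = M"
  unfolding ffact_poly_def by (subst degree_prod_eq_sum_degree) auto

lemma poly_ffact_poly: "poly (ffact_poly M) (real N) = fact M * real (N choose M)"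
  by (simp add: ffact_poly_def poly_prod binomial_gbinomial gbinomial_prod_rev atLeast0LessThan)

lemma poly_ffact_poly_eq_fact_div:
  assumes "m \<le> N"
  shows "poly (ffact_poly m) (real N) = fact N / fact (N - m)"
  using assms by (simp add: poly_ffact_poly binomial_fact)

lemma pcompose_power: "(P ^ n) \<circ>\<^sub>p Q = (P \<circ>\<^sub>p Q) ^ n" for P Q :: "real poly"
  by (induction n) (simp_all add: pcompose_mult pcompose_1)

text \<open>The factor \<open>(X - M + 1)\<^sup>p\<close> is coprime to \<open>(X + 1)\<^sup>q\<close>, hence divides \<open>P\<close>; cancelling it
  gives the same equation for \<open>M - 1\<close>. For \<open>M = 0\<close> the degrees of the three terms are incompatible.\<close>

lemma shift_equation_imp_zero:
  fixes A P :: "real poly" and c :: real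
  assumes eq: "(P \<circ>\<^sub>p [:1, 1:]) * [:1 - real M, 1:] ^ p
      = smult c ([:1, 1:] ^ q * P) + (A \<circ>\<^sub>p [:1, 1:]) * ffact_poly M ^ p"
    and "c \<noteq> 0" "p < q" "degree A < q"
  shows "A = 0"
  using eq
proof (induction M arbitrary: P)
  case 0
  have eq0: "(P \<circ>\<^sub>p [:1, 1:]) * [:1, 1:] ^ p
      = smult c ([:1, 1:] ^ q * P) + (A \<circ>\<^sub>p [:1, 1:])"
    using 0 by (simp add: ffact_poly_def)
  show ?case
  proof (cases "P = 0")
    case True
    then have "A \<circ>\<^sub>p [:1, 1:] = 0" using eq0 by simp
    then show ?thesis by (simp add: pcompose_eq_0_iff)
  next
    case False
    have "degree ((P \<circ>\<^sub>p [:1, 1:]) * [:1, 1:] ^ p) \<le> degree P + p"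
      by (rule order_trans[OF degree_mult_le]) (simp add: degree_pcompose degree_power_eq)
    moreover have "degree (A \<circ>\<^sub>p [:1, 1:]) < q"
      using \<open>degree A < q\<close> by (simp add: degree_pcompose)
    moreover have "degree (smult c ([:1, 1:] ^ q * P)) = degree P + q"
      using False \<open>c \<noteq> 0\<close> by (simp add: degree_mult_eq degree_power_eq)
    moreover have "smult c ([:1, 1:] ^ q * P)
        = (P \<circ>\<^sub>p [:1, 1:]) * [:1, 1:] ^ p - A \<circ>\<^sub>p [:1, 1:]"
      using eq0 by simp
    moreover have "degree ((P \<circ>\<^sub>p [:1, 1:]) * [:1, 1:] ^ p - A \<circ>\<^sub>p [:1, 1:]) < degree P + q"
      using calculation(1,2) \<open>p < q\<close> by (intro degree_diff_less) simp_all
    ultimately show ?thesis by simp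
  qed
next
  case (Suc M)
  define X where "X = [:- real M, 1:]"
  have X: "[:1 - real (Suc M), 1:] = X" by (simp add: X_def)
  have ff: "ffact_poly (Suc M) = ffact_poly M * X" by (simp add: ffact_poly_def X_def)
  have eqS: "(P \<circ>\<^sub>p [:1, 1:]) * X ^ p
      = smult c ([:1, 1:] ^ q * P) + (A \<circ>\<^sub>p [:1, 1:]) * ffact_poly M ^ p * X ^ p"
    using Suc.prems unfolding X ff by (simp add: power_mult_distrib mult.assoc)
  have "X ^ p dvd P"
  proof (cases "P = 0")
    case False
    have "smult c ([:1, 1:] ^ q * P) = X ^ p * (P \<circ>\<^sub>p [:1, 1:] - (A \<circ>\<^sub>p [:1, 1:]) * ffact_poly M ^ p)"
      using eqS by (simp add: algebra_simps)
    then have "X ^ p dvd [:1, 1:] ^ q * P"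
      using \<open>c \<noteq> 0\<close> by (metis dvd_smult_cancel dvd_triv_left)
    then have "p \<le> order (real M) ([:1, 1:] ^ q * P)"
      using False unfolding X_def order_divides by simp
    also have "\<dots> = order (real M) P"
      using False by (simp add: order_mult order_0I)
    finally show ?thesis unfolding X_def order_divides by simp
  qed simp
  then obtain P' where P': "P = X ^ p * P'" by blast
  have Xs: "X \<circ>\<^sub>p [:1, 1:] = [:1 - real M, 1:]" by (simp add: X_def pcompose_pCons)
  have "X ^ p * ((P' \<circ>\<^sub>p [:1, 1:]) * [:1 - real M, 1:] ^ p)
      = X ^ p * (smult c ([:1, 1:] ^ q * P') + (A \<circ>\<^sub>p [:1, 1:]) * ffact_poly M ^ p)"
    using eqS unfolding P' by (simp add: pcompose_mult pcompose_power Xs algebra_simps)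
  then have "(P' \<circ>\<^sub>p [:1, 1:]) * [:1 - real M, 1:] ^ p
      = smult c ([:1, 1:] ^ q * P') + (A \<circ>\<^sub>p [:1, 1:]) * ffact_poly M ^ p"
    by (simp add: X_def)
  then show ?case by (rule Suc.IH)
qed

section \<open>Geometric growth of polynomials and integrality of factorial quotients\<close>

text \<open>Each Horner step costs a factor \<open>n \<le> 2 ^ n\<close>, absorbed by doubling the
  base.\<close>

lemma abs_poly_le_power:
  fixes A :: "real poly"
  shows "\<exists>K B. 0 \<le> K \<and> 1 \<le> B \<and> (\<forall>n::nat. \<bar>poly A (real n)\<bar> \<le> K * B ^ n)"
proof (induction A)
  case 0
  then show ?case by (intro exI[of _ 0] exI[of _ 1]) simp
next
  case (pCons c A)
  then obtain K B where KB: "0 \<le> K" "1 \<le> B" "\<And>n::nat. \<bar>poly A (real n)\<bar> \<le> K * B ^ n" by blast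
  have "\<bar>poly (pCons c A) (real n)\<bar> \<le> (\<bar>c\<bar> + K) * (2 * B) ^ n" for n :: nat
  proof -
    have "\<bar>poly (pCons c A) (real n)\<bar> \<le> \<bar>c\<bar> + real n * \<bar>poly A (real n)\<bar>"
      by (simp add: abs_mult order_trans[OF abs_triangle_ineq])
    also have "\<dots> \<le> \<bar>c\<bar> * (2 * B) ^ n + 2 ^ n * (K * B ^ n)"
    proof (intro add_mono mult_mono KB)
      show "\<bar>c\<bar> \<le> \<bar>c\<bar> * (2 * B) ^ n"
        using KB one_le_power[of "2 * B" n] by (simp add: mult_le_cancel_left1)
      show "real n \<le> 2 ^ n" by (rule less_imp_le) (rule of_nat_less_two_power)
    qed simp_all
    also have "\<dots> = (\<bar>c\<bar> + K) * (2 * B) ^ n" by (simp add: power_mult_distrib algebra_simps)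
    finally show ?thesis .
  qed
  then show ?case using KB by (intro exI[of _ "\<bar>c\<bar> + K"] exI[of _ "2 * B"]) simp
qed

text \<open>The quotient is \<open>N choose m\<close> times \<open>fact m / fact M\<close>. This is
  the source of the factor \<open>fact M ^ d\<close> in the late summands of
  \<open>T\<close>.\<close>

lemma fact_div_fact_Ints:
  assumes "M \<le> m" "m \<le> N"
  shows "fact N / (fact (N - m) * fact M) \<in> (\<int> :: real set)"
proof -
  have "fact N / (fact (N - m) * fact M) = real (N choose m) * (fact m / fact M)"
    using assms by (simp add: binomial_fact)
  moreover have "fact m / fact M \<in> (\<int> :: real set)"
  proof -
    obtain k where "fact m = fact M * (k :: nat)" using fact_dvd[OF assms(1), where 'a = nat] by blast
    then have "(fact m :: real) = fact M * real k" by (metis of_nat_fact of_nat_mult)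
    then show ?thesis by simp
  qed
  ultimately show ?thesis by (simp only: Ints_mult Ints_of_nat)
qed

section \<open>Scaled partial sums of a vanishing series\<close>

text \<open>The relation after multiplication by \<open>z\<close> and clearing of denominators. If
  \<open>z = a / b\<close>, then \<open>a / z\<close> is \<open>b\<close>, so powers of
  \<open>a\<close> clear those of \<open>1 / z\<close>.\<close>

locale vanishing_series =
  fixes p d :: nat and z \<gamma> :: real and a :: int and A :: "real poly"
  assumes d_pos: "0 < d" and z_nz: "z \<noteq> 0" and a_nz: "a \<noteq> 0"
    and a_div_z_Ints: "of_int a / z \<in> \<int>" and \<gamma>_Ints: "\<gamma> \<in> \<int>"
    and A_Ints: "\<And>n::nat. poly A (real n) \<in> \<int>"
    and degree_A: "degree A < p + d"
    and series_sums: "(\<lambda>n. poly A (real (Suc n)) / real (Suc n) ^ p * z ^ Suc n / fact (Suc n) ^ d) sums - \<gamma>"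
begin

definition coef :: "nat \<Rightarrow> real" where
  "coef n = poly A (real n) / real n ^ p * z ^ n / fact n ^ d"

definition T :: "nat \<Rightarrow> real" where
  "T N = fact N ^ d / z ^ N * (\<gamma> + (\<Sum>i<N. coef (Suc i)))"

lemma T_Suc:
  "T (Suc N) = real (Suc N) ^ d / z * T N + poly A (real (Suc N)) / real (Suc N) ^ p"
proof -
  have "T (Suc N) = fact (Suc N) ^ d / z ^ Suc N * (\<gamma> + (\<Sum>i<N. coef (Suc i)))
      + fact (Suc N) ^ d / z ^ Suc N * coef (Suc N)"
    unfolding T_def by (simp only: sum.lessThan_Suc flip: distrib_left add.assoc)
  also have "fact (Suc N) ^ d / z ^ Suc N * coef (Suc N) = poly A (real (Suc N)) / real (Suc N) ^ p"
    using z_nz by (simp add: coef_def del: fact_Suc power_Suc)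
  also have "fact (Suc N) ^ d / z ^ Suc N * (\<gamma> + (\<Sum>i<N. coef (Suc i))) = real (Suc N) ^ d / z * T N"
    by (simp add: T_def power_mult_distrib del: of_nat_Suc)
  finally show ?thesis .
qed

text \<open>The sum is counted from its top index: \<open>fact N / fact (N - m)\<close> is a
  polynomial in \<open>N\<close> for fixed \<open>m\<close>, and a multiple of \<open>fact M\<close>
  for \<open>m \<ge> M\<close>.\<close>

lemma T_eq_sum:
  "T N = \<gamma> * fact N ^ d * (1 / z) ^ N
    + (\<Sum>m<N. (fact N / fact (N - m)) ^ d * poly A (real (N - m)) / real (N - m) ^ p * (1 / z) ^ m)"
proof -
  have "(\<Sum>i<N. coef (Suc i)) = (\<Sum>i<N. coef (N - i))"
    by (subst sum.nat_diff_reindex[symmetric]) (intro sum.cong, auto simp: Suc_diff_Suc)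
  moreover have "fact N ^ d / z ^ N * coef (N - m)
      = (fact N / fact (N - m)) ^ d * poly A (real (N - m)) / real (N - m) ^ p * (1 / z) ^ m"
    if "m < N" for m
  proof -
    have "z ^ N = z ^ (N - m) * z ^ m" using that by (simp flip: power_add)
    then show ?thesis using z_nz by (simp add: coef_def power_divide)
  qed
  ultimately show ?thesis
    by (simp add: T_def distrib_left sum_distrib_left power_divide)
qed

text \<open>Since the whole series vanishes, a partial sum is minus a tail, and \<open>N!\<^sup>d\<close> times the tail
  grows at most geometrically.\<close>

lemma abs_T_le_power:
  obtains K B where "0 \<le> K" "1 \<le> B" "\<And>N. \<bar>T N\<bar> \<le> K * B ^ N"
proof -
  obtain K B where KB: "0 \<le> K" "1 \<le> B" "\<And>n::nat. \<bar>poly A (real n)\<bar> \<le> K * B ^ n"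
    using abs_poly_le_power by blast
  \<comment> \<open>The powers of \<open>z\<close> cancel up to \<open>z ^ Suc i\<close>; together
    with \<open>B ^ Suc i\<close> from the bound on \<open>A\<close> they make the exponential
    series in \<open>y\<close> a majorant.\<close>
  define y where "y = B * \<bar>z\<bar>"
  have y: "0 \<le> y" using KB by (simp add: y_def)
  have bound: "\<bar>fact N ^ d / z ^ N * coef (Suc (i + N))\<bar> \<le> K * y * B ^ N * (y ^ i / fact i)" for N i
  proof -
    have ch: "fact N * fact i \<le> (fact (Suc (i + N)) :: real)"
    proof -
      have "fact N * fact i \<le> (fact N * fact i) * (real ((i + N) choose i))"
        using mult_left_mono[of 1 "real ((i + N) choose i)" "fact N * fact i"] by (simp add: Suc_le_eq)
      also have "\<dots> = fact (i + N)"
        using binomial_fact_lemma[of i "i + N"]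
        by (metis (no_types, lifting) add_diff_cancel_left' le_add1 mult.commute of_nat_fact of_nat_mult)
      also have "\<dots> \<le> fact (Suc (i + N))" by (intro fact_mono) simp
      finally show ?thesis .
    qed
    have f1: "fact N / fact (Suc (i + N)) \<le> 1 / (fact i :: real)"
      using ch by (simp add: field_simps del: fact_Suc)
    \<comment> \<open>The quotient is at most 1, so for \<open>d \<ge> 1\<close> its power is
      bounded by the quotient itself.\<close>
    have "(fact N / fact (Suc (i + N)) :: real) ^ d \<le> fact N / fact (Suc (i + N))"
    proof -
      have "(fact N / fact (Suc (i + N)) :: real) ^ d \<le> (fact N / fact (Suc (i + N))) ^ 1"
        using d_pos by (intro power_decreasing) (auto simp del: fact_Suc intro!: fact_mono)
      then show ?thesis by simp
    qed
    with f1 have f2: "(fact N / fact (Suc (i + N)) :: real) ^ d \<le> 1 / fact i" by linarith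
    have Ap: "\<bar>poly A (real (Suc (i + N)))\<bar> / real (Suc (i + N)) ^ p \<le> K * B ^ Suc (i + N)"
    proof -
      have "\<bar>poly A (real (Suc (i + N)))\<bar> / real (Suc (i + N)) ^ p \<le> \<bar>poly A (real (Suc (i + N)))\<bar> / 1"
        by (intro divide_left_mono one_le_power) simp_all
      then show ?thesis using KB(3)[of "Suc (i + N)"] by simp
    qed
    have "\<bar>fact N ^ d / z ^ N * coef (Suc (i + N))\<bar>
        = (fact N / fact (Suc (i + N))) ^ d * (\<bar>poly A (real (Suc (i + N)))\<bar> / real (Suc (i + N)) ^ p) * \<bar>z\<bar> ^ Suc i"
      using z_nz unfolding coef_def
      by (simp add: abs_mult power_abs power_divide power_add mult_ac del: fact_Suc of_nat_Suc)
    also have "\<dots> \<le> (1 / fact i) * (K * B ^ Suc (i + N)) * \<bar>z\<bar> ^ Suc i"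
      using KB by (intro mult_mono f2 Ap mult_nonneg_nonneg divide_nonneg_nonneg) simp_all
    also have "\<dots> = K * y * B ^ N * (y ^ i / fact i)"
      by (simp add: y_def power_mult_distrib power_add)
    finally show ?thesis .
  qed
  have "\<bar>T N\<bar> \<le> (K * y * exp y) * B ^ N" for N
  proof -
    have sm: "(\<lambda>i. coef (Suc i)) sums - \<gamma>" using series_sums by (simp only: coef_def)
    have "(\<lambda>i. coef (Suc (i + N))) sums (- \<gamma> - (\<Sum>i<N. coef (Suc i)))"
      using sums_split_initial_segment[OF sm, of N] by simp
    from sums_mult[OF this, of "fact N ^ d / z ^ N"]
    have s1: "(\<lambda>i. fact N ^ d / z ^ N * coef (Suc (i + N))) sums (- T N)"
      by (simp add: T_def algebra_simps)
    have s2: "(\<lambda>i. K * y * B ^ N * (y ^ i / fact i)) sums (K * y * B ^ N * exp y)"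
      using exp_converges[of y] by (intro sums_mult) (simp add: divide_inverse mult.commute)
    have "\<bar>\<Sum>i. fact N ^ d / z ^ N * coef (Suc (i + N))\<bar> \<le> (\<Sum>i. K * y * B ^ N * (y ^ i / fact i))"
      using bound by (intro norm_suminf_le[where 'a = real, simplified real_norm_def] sums_summable[OF s2]) simp
    then show ?thesis using sums_unique[OF s1] sums_unique[OF s2] by (simp add: mult_ac)
  qed
  then show thesis using that[of "K * y * exp y" B] KB y by simp
qed

text \<open>\<open>N choose M\<close> contains the factor \<open>N - m\<close> for each
  \<open>m < M\<close>, so its \<open>p\<close>-th power cancels the denominator
  \<open>(N - m) ^ p\<close>; the product over \<open>i \<noteq> m\<close> is what remains.\<close>

definition low_poly :: "nat \<Rightarrow> real poly" where
  "low_poly M = (\<Sum>m<M. smult ((1 / z) ^ m / fact M ^ p)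
     ((\<Prod>i\<in>{..<M} - {m}. [:- real i, 1:]) ^ p * ffact_poly m ^ d * (A \<circ>\<^sub>p [:- real m, 1:])))"

text \<open>The three factors have degrees at most \<open>(M - 1) * p\<close>, at most
  \<open>(M - 1) * d\<close> as \<open>m < M\<close>, and less than \<open>p + d\<close>.\<close>

lemma degree_low_poly:
  assumes "0 < M"
  shows "degree (low_poly M) < M * (p + d)"
  unfolding low_poly_def
proof (rule degree_sum_less)
  fix m assume m: "m \<in> {..<M}"
  have "degree (\<Prod>i\<in>{..<M} - {m}. [:- real i, 1:]) = M - 1"
    using m by (subst degree_prod_eq_sum_degree) auto
  then have "degree ((\<Prod>i\<in>{..<M} - {m}. [:- real i, 1:]) ^ p) \<le> (M - 1) * p"
    using degree_power_le[of "\<Prod>i\<in>{..<M} - {m}. [:- real i, 1:]" p] by simp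
  moreover have "degree (ffact_poly m ^ d) \<le> (M - 1) * d"
    using m by (intro order_trans[OF degree_power_le] mult_le_mono) auto
  moreover have "degree (A \<circ>\<^sub>p [:- real m, 1:]) < p + d" using degree_A by (simp add: degree_pcompose)
  ultimately have "degree ((\<Prod>i\<in>{..<M} - {m}. [:- real i, 1:]) ^ p * ffact_poly m ^ d * (A \<circ>\<^sub>p [:- real m, 1:]))
      < (M - 1) * p + (M - 1) * d + (p + d)"
    using degree_mult_le[of "(\<Prod>i\<in>{..<M} - {m}. [:- real i, 1:]) ^ p * ffact_poly m ^ d" "A \<circ>\<^sub>p [:- real m, 1:]"]
      degree_mult_le[of "(\<Prod>i\<in>{..<M} - {m}. [:- real i, 1:]) ^ p" "ffact_poly m ^ d"]
    by linarith
  also have "(M - 1) * p + (M - 1) * d + (p + d) = M * (p + d)"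
    using assms by (cases M) (auto simp: algebra_simps)
  finally show "degree (smult ((1 / z) ^ m / fact M ^ p)
     ((\<Prod>i\<in>{..<M} - {m}. [:- real i, 1:]) ^ p * ffact_poly m ^ d * (A \<circ>\<^sub>p [:- real m, 1:]))) < M * (p + d)"
    by (rule le_less_trans[OF degree_smult_le])
qed (use assms d_pos in simp)

lemma poly_low_poly:
  assumes "M \<le> N"
  shows "poly (low_poly M) (real N) = real (N choose M) ^ p *
    (\<Sum>m<M. (fact N / fact (N - m)) ^ d * poly A (real (N - m)) / real (N - m) ^ p * (1 / z) ^ m)"
  unfolding low_poly_def poly_sum sum_distrib_left
proof (rule sum.cong)
  fix m assume "m \<in> {..<M}"
  then have m: "m < M" "m < N" "m \<le> N" using assms by auto
  have r: "real (N - m) = real N - real m" "real (N - m) \<noteq> 0" using m by auto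
  define G where "G = poly (\<Prod>i\<in>{..<M} - {m}. [:- real i, 1:]) (real N)"
  have "ffact_poly M = [:- real m, 1:] * (\<Prod>i\<in>{..<M} - {m}. [:- real i, 1:])"
    unfolding ffact_poly_def using m by (subst prod.remove[of _ m]) auto
  then have "poly (ffact_poly M) (real N) = real (N - m) * G"
    by (simp only: poly_mult G_def) (simp add: r)
  then have "real (N choose M) = real (N - m) * G / fact M"
    by (simp add: poly_ffact_poly field_simps)
  then have G: "real (N choose M) ^ p = real (N - m) ^ p * G ^ p / fact M ^ p"
    by (simp add: power_mult_distrib power_divide)
  have "poly (A \<circ>\<^sub>p [:- real m, 1:]) (real N) = poly A (real (N - m))"
    using r by (simp add: poly_pcompose)
  then show "poly (smult ((1 / z) ^ m / fact M ^ p)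
       ((\<Prod>i\<in>{..<M} - {m}. [:- real i, 1:]) ^ p * ffact_poly m ^ d * (A \<circ>\<^sub>p [:- real m, 1:]))) (real N)
    = real (N choose M) ^ p *
      ((fact N / fact (N - m)) ^ d * poly A (real (N - m)) / real (N - m) ^ p * (1 / z) ^ m)"
    using r(2) unfolding G poly_smult poly_mult poly_power G_def[symmetric] poly_ffact_poly_eq_fact_div[OF m(3)]
    by simp
qed simp

text \<open>Here \<open>a ^ L\<close> clears the powers of \<open>1 / z\<close>,
  \<open>D ^ p\<close> clears \<open>(N - m) ^ p\<close>, and \<open>fact_div_fact_Ints\<close>
  absorbs \<open>fact M ^ d\<close>. The multiplier does not depend on \<open>N\<close>, so it
  serves a whole iterated difference.\<close>

lemma remainder_Ints:
  assumes MN: "M \<le> N" "N \<le> L" and D: "\<And>j. j \<in> {1..L} \<Longrightarrow> j dvd (D::nat)"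
  shows "of_int a ^ L * real D ^ p / fact M ^ d * (real (N choose M) ^ p * T N - poly (low_poly M) (real N)) \<in> \<int>"
proof -
  have az: "of_int a ^ L * (1 / z) ^ m \<in> \<int>" if "m \<le> L" for m
  proof -
    have "of_int a ^ L * (1 / z) ^ m = (of_int a / z) ^ m * of_int a ^ (L - m)"
      using that by (simp add: power_divide flip: power_add)
    then show ?thesis using a_div_z_Ints by simp
  qed
  define s where "s m = (fact N / fact (N - m)) ^ d * poly A (real (N - m)) / real (N - m) ^ p * (1 / z) ^ m" for m
  have "{..<N} = {..<M} \<union> {M..<N}" using MN by auto
  then have "(\<Sum>m<N. s m) = (\<Sum>m<M. s m) + (\<Sum>m\<in>{M..<N}. s m)"
    using sum.union_disjoint[of "{..<M}" "{M..<N}" s] by (simp add: ivl_disj_int)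
  then have eq: "real (N choose M) ^ p * T N - poly (low_poly M) (real N)
      = real (N choose M) ^ p * (\<gamma> * fact N ^ d * (1 / z) ^ N + (\<Sum>m\<in>{M..<N}. s m))"
    unfolding T_eq_sum poly_low_poly[OF MN(1)] s_def[symmetric] by (simp add: algebra_simps)
  have t1: "of_int a ^ L * real D ^ p / fact M ^ d * (\<gamma> * fact N ^ d * (1 / z) ^ N) \<in> \<int>"
  proof -
    \<comment> \<open>The constant is handled like a summand with \<open>m = N\<close>;
      \<open>fact (N - N) = 1\<close> is inserted for this.\<close>
    have "of_int a ^ L * real D ^ p / fact M ^ d * (\<gamma> * fact N ^ d * (1 / z) ^ N)
        = (of_int a ^ L * (1 / z) ^ N) * real D ^ p * \<gamma> * (fact N / (fact (N - N) * fact M)) ^ d"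
      by (simp add: power_divide mult_ac)
    also have "\<dots> \<in> \<int>"
      by (intro Ints_mult az MN Ints_power \<gamma>_Ints fact_div_fact_Ints) simp_all
    finally show ?thesis .
  qed
  have t2: "of_int a ^ L * real D ^ p / fact M ^ d * s m \<in> \<int>" if m: "m \<in> {M..<N}" for m
  proof -
    from m MN have "N - m \<in> {1..L}" by auto
    from D[OF this] obtain e where "D = (N - m) * e" by blast
    moreover have "real (N - m) \<noteq> 0" using m by auto
    ultimately have "real D / real (N - m) = real e" by (simp del: of_nat_diff)
    then have Dm: "real D / real (N - m) \<in> \<int>" by simp
    have "of_int a ^ L * real D ^ p / fact M ^ d * s m = (of_int a ^ L * (1 / z) ^ m)
        * (real D / real (N - m)) ^ p * (fact N / (fact (N - m) * fact M)) ^ d * poly A (real (N - m))"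
      by (simp add: s_def power_divide power_mult_distrib mult_ac)
    also have "\<dots> \<in> \<int>"
      using m MN by (intro Ints_mult az Ints_power Dm A_Ints fact_div_fact_Ints) simp_all
    finally show ?thesis .
  qed
  have "of_int a ^ L * real D ^ p / fact M ^ d * (real (N choose M) ^ p * T N - poly (low_poly M) (real N))
      = real (N choose M) ^ p * (of_int a ^ L * real D ^ p / fact M ^ d * (\<gamma> * fact N ^ d * (1 / z) ^ N)
        + (\<Sum>m\<in>{M..<N}. of_int a ^ L * real D ^ p / fact M ^ d * s m))"
    unfolding eq sum_distrib_left[symmetric] by (simp add: distrib_left mult_ac)
  also have "\<dots> \<in> \<int>" by (intro Ints_mult Ints_add Ints_sum t1 t2 Ints_power) simp_all
  finally show ?thesis .
qed

text \<open>The difference of order \<open>M (p + d)\<close> annihilates \<^const>\<open>low_poly\<close>. What remains is divisible by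
  \<open>M!\<^sup>d\<close> up to a denominator of geometric growth, while being of geometric size.\<close>

lemma fdiff_funpow_zero:
  "\<exists>M0. \<forall>M\<ge>M0. \<forall>n\<in>{M..M + M}. (fdiff ^^ (M * (p + d))) (\<lambda>N. real (N choose M) ^ p * T N) n = 0"
proof -
  obtain K B where KB: "0 \<le> K" "1 \<le> B" "\<And>N. \<bar>T N\<bar> \<le> K * B ^ N" using abs_T_le_power by blast
  \<comment> \<open>Chosen so that \<open>M * r = k + 2 * M\<close> for
    \<open>k = M * (p + d)\<close>, which bounds all arguments \<open>n, ..., n + k\<close> with
    \<open>n \<le> 2 * M\<close>.\<close>
  define r where "r = p + d + 2"
  \<comment> \<open>Collects the geometric factors: \<open>\<bar>a\<bar>\<close> and
    \<open>8 ^ p\<close> from the multiplier, 2 from the iterated difference, \<open>2 ^ p\<close>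
    from the binomial, \<open>B\<close> from \<open>T\<close>.\<close>
  define C where "C = \<bar>real_of_int a\<bar> * 8 ^ p * 2 * (2 ^ p * B)"
  have "(\<lambda>n. inverse (fact n) * (C ^ r) ^ n) \<longlonglongrightarrow> 0"
    by (rule summable_LIMSEQ_zero) (rule summable_exp)
  then have "(\<lambda>n. K * (inverse (fact n) * (C ^ r) ^ n)) \<longlonglongrightarrow> 0"
    by (rule tendsto_mult_right_zero)
  then have "eventually (\<lambda>n. K * (inverse (fact n) * (C ^ r) ^ n) < 1) sequentially"
    by (rule order_tendstoD) simp
  then obtain M0 where M0: "\<And>n. n \<ge> M0 \<Longrightarrow> K * (inverse (fact n) * (C ^ r) ^ n) < 1"
    by (auto simp: eventually_sequentially)
  show ?thesis
  \<comment> \<open>\<open>Suc M0\<close> instead of \<open>M0\<close> keeps \<open>M\<close>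
    positive, as \<open>degree_low_poly\<close> demands.\<close>
  proof (intro exI[of _ "Suc M0"] allI impI ballI)
    fix M n assume M: "Suc M0 \<le> M" and n: "n \<in> {M..M + M}"
    define k where "k = M * (p + d)"
    define L where "L = M * r"
    have L: "L = k + 2 * M" by (simp add: L_def k_def r_def)
    define u where "u N = real (N choose M) ^ p * T N" for N
    define w where "w = (fdiff ^^ k) u n"
    obtain D :: nat where D: "0 < D" "D \<le> 8 ^ L" "\<And>j. j \<in> {1..L} \<Longrightarrow> j dvd D"
      using common_multiple_le_power by blast
    define E where "E = of_int a ^ L * real D ^ p / fact M ^ d"
    have E_nz: "E \<noteq> 0" using a_nz D(1) by (simp add: E_def)
    have "E * (fdiff ^^ k) (\<lambda>N. u N - poly (low_poly M) (real N)) n \<in> \<int>"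
    proof (rule fdiff_funpow_Ints)
      fix N assume "N \<in> {n..n + k}"
      then show "E * (u N - poly (low_poly M) (real N)) \<in> \<int>"
        using n L unfolding E_def u_def by (intro remainder_Ints D) auto
    qed
    moreover have "(fdiff ^^ k) (\<lambda>N. poly (low_poly M) (real N)) n = 0"
      using M degree_low_poly[of M] unfolding k_def by (intro fdiff_funpow_poly) simp
    ultimately have Ew: "E * w \<in> \<int>" by (simp add: fdiff_funpow_diff w_def)
    have "\<bar>u N\<bar> \<le> K * (2 ^ p * B) ^ L" if N: "N \<in> {n..n + k}" for N
    proof -
      have NL: "N \<le> L" using N n L by auto
      have "real (N choose M) \<le> 2 ^ N" using binomial_le_pow2[of N M] by (metis of_nat_le_iff of_nat_numeral of_nat_power)
      then have "real (N choose M) ^ p \<le> (2 ^ N) ^ p" by (intro power_mono) simp_all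
      then have "\<bar>u N\<bar> \<le> (2 ^ N) ^ p * (K * B ^ N)"
        unfolding u_def abs_mult using KB by (intro mult_mono) simp_all
      also have "\<dots> = K * (2 ^ p * B) ^ N" by (simp add: power_mult_distrib mult.commute flip: power_mult)
      also have "\<dots> \<le> K * (2 ^ p * B) ^ L"
        using KB NL mult_mono[of 1 "2 ^ p" 1 B] by (intro mult_left_mono power_increasing) simp_all
      finally show ?thesis .
    qed
    then have w: "\<bar>w\<bar> \<le> 2 ^ k * (K * (2 ^ p * B) ^ L)"
      unfolding w_def by (rule abs_fdiff_funpow_le)
    have "\<bar>E * w\<bar> = (\<bar>real_of_int a\<bar> ^ L * real D ^ p / fact M ^ d) * \<bar>w\<bar>"
      by (simp add: E_def abs_mult power_abs)
    also have "\<dots> \<le> (\<bar>real_of_int a\<bar> ^ L * (8 ^ L) ^ p / fact M) * (2 ^ L * (K * (2 ^ p * B) ^ L))"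
    proof (intro mult_mono frac_le)
      have "real D \<le> 8 ^ L" using D(2) by (metis of_nat_le_iff of_nat_numeral of_nat_power)
      then show "real D ^ p \<le> (8 ^ L) ^ p" by (intro power_mono) simp_all
      show "(fact M :: real) \<le> fact M ^ d" using d_pos by (intro self_le_power) simp_all
      have "(2::real) ^ k * (K * (2 ^ p * B) ^ L) \<le> 2 ^ L * (K * (2 ^ p * B) ^ L)"
        using L KB by (intro mult_right_mono power_increasing) simp_all
      then show "\<bar>w\<bar> \<le> 2 ^ L * (K * (2 ^ p * B) ^ L)" using w by linarith
    qed simp_all
    also have "\<dots> = K * (inverse (fact M) * C ^ L)"
      by (simp add: C_def power_mult_distrib divide_inverse mult_ac flip: power_mult)
    also have "C ^ L = (C ^ r) ^ M" by (simp add: L_def mult.commute flip: power_mult)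
    also have "K * (inverse (fact M) * (C ^ r) ^ M) < 1" using M by (intro M0) simp
    finally have "E * w = 0" using Ew by (meson Ints_nonzero_abs_less1)
    then have "w = 0" using E_nz by simp
    then show "(fdiff ^^ (M * (p + d))) (\<lambda>N. real (N choose M) ^ p * T N) n = 0"
      unfolding w_def k_def u_def .
  qed
qed

text \<open>Multiplied by the \<open>p\<close>-th power of the falling factorial of
  \<open>n + 1\<close> times \<open>n + 1 - M\<close>, the recurrence for \<open>T\<close> becomes a
  polynomial equation at \<open>M + k\<close> points. The degrees are smaller than that, so it is an
  identity and \<open>shift_equation_imp_zero\<close> applies.\<close>

theorem poly_eq_0: "A = 0"
proof -
  obtain M0 where M0: "\<And>M n. M \<ge> M0 \<Longrightarrow> n \<in> {M..M + M} \<Longrightarrow>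
      (fdiff ^^ (M * (p + d))) (\<lambda>N. real (N choose M) ^ p * T N) n = 0"
    using fdiff_funpow_zero by blast
  \<comment> \<open>\<open>M \<ge> p + d\<close> gives \<open>(M + 1) * (p + d) \<le> M + k\<close>:
    as many points as the strict degree bound.\<close>
  define M where "M = max M0 (p + d)"
  have M: "M \<ge> M0" "M \<ge> p + d" "0 < M" using d_pos by (auto simp: M_def)
  define k where "k = M * (p + d)"
  obtain P where P: "P = 0 \<or> degree P < k"
      "\<And>n. n \<in> {M..M + M + k} \<Longrightarrow> real (n choose M) ^ p * T n = poly P (real n)"
    using fdiff_funpow_zero_imp_poly[OF M0[OF M(1)]] unfolding k_def by blast
  define Q where "Q = smult (fact M ^ p) P"
  have k: "0 < k" using M d_pos by (simp add: k_def)
  have dQ: "degree Q < k" using P(1) k by (auto simp: Q_def)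
  have Q: "poly (ffact_poly M) (real n) ^ p * T n = poly Q (real n)" if "n \<in> {M..M + M + k}" for n
    using P(2)[OF that] by (simp add: Q_def poly_ffact_poly power_mult_distrib)
  define lhs where "lhs = (Q \<circ>\<^sub>p [:1, 1:]) * [:1 - real M, 1:] ^ p"
  define rhs where "rhs = smult (1 / z) ([:1, 1:] ^ (p + d) * Q) + (A \<circ>\<^sub>p [:1, 1:]) * ffact_poly M ^ p"
  have roots: "poly (lhs - rhs) (real n) = 0" if n: "n \<in> {M..<M + M + k}" for n
  proof -
    have Q1: "poly Q (real (Suc n)) = poly (ffact_poly M) (real (Suc n)) ^ p * T (Suc n)"
      and Q0: "poly Q (real n) = poly (ffact_poly M) (real n) ^ p * T n"
      using Q[of "Suc n"] Q[of n] n by auto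
    \<comment> \<open>Both sides are the falling factorial of \<open>n + 1\<close> with
      \<open>M + 1\<close> factors; the \<open>p\<close>-th power of \<open>Suc n\<close> then
      cancels the denominator in \<open>T_Suc\<close>.\<close>
    have shift: "poly (ffact_poly M) (real (Suc n)) * (1 - real M + real n) = real (Suc n) * poly (ffact_poly M) (real n)"
    proof -
      have "fact n / fact (n - M) * real (Suc n) = (fact (Suc n) :: real) / fact (n - M)" by simp
      moreover have "fact (Suc n - M) = (1 - real M + real n) * fact (n - M)"
        using n by (simp add: Suc_diff_le)
      moreover have "1 - real M + real n \<noteq> 0" using n by auto
      ultimately show ?thesis
        using n poly_ffact_poly_eq_fact_div[of M n] poly_ffact_poly_eq_fact_div[of M "Suc n"]
        by (simp del: fact_Suc of_nat_Suc) (simp add: mult.commute)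
    qed
    have "poly lhs (real n) = (poly (ffact_poly M) (real (Suc n)) * (1 - real M + real n)) ^ p * T (Suc n)"
      using Q1 by (simp add: lhs_def poly_pcompose power_mult_distrib add.commute)
    also have "\<dots> = (real (Suc n) * poly (ffact_poly M) (real n)) ^ p
        * (real (Suc n) ^ d / z * T n + poly A (real (Suc n)) / real (Suc n) ^ p)"
      unfolding shift T_Suc ..
    also have "\<dots> = real (Suc n) ^ (p + d) / z * poly Q (real n) + poly A (real (Suc n)) * poly (ffact_poly M) (real n) ^ p"
      unfolding Q0 by (simp add: power_mult_distrib power_add distrib_left mult_ac del: of_nat_Suc)
    also have "\<dots> = poly rhs (real n)"
      by (simp add: rhs_def poly_pcompose)
    finally show ?thesis by simp
  qed
  have "lhs - rhs = 0"
  proof (rule ccontr)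
    assume nz: "lhs - rhs \<noteq> 0"
    have "degree lhs < (M + 1) * (p + d)"
    proof -
      have "degree ([:1 - real M, 1:] ^ p) \<le> p" by (simp add: degree_power_eq)
      then show ?thesis
        using degree_mult_le[of "Q \<circ>\<^sub>p [:1, 1:]" "[:1 - real M, 1:] ^ p"] dQ
        by (simp add: lhs_def k_def degree_pcompose)
    qed
    moreover have "degree rhs < (M + 1) * (p + d)"
      unfolding rhs_def
    proof (rule degree_add_less)
      have "degree ([:1, 1:] ^ (p + d) * Q) \<le> degree ([:1, 1:] ^ (p + d) :: real poly) + degree Q"
        by (rule degree_mult_le)
      then show "degree (smult (1 / z) ([:1, 1:] ^ (p + d) * Q)) < (M + 1) * (p + d)"
        using dQ z_nz by (simp add: k_def degree_power_eq)
      have "degree (ffact_poly M ^ p) \<le> M * (p + d)"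
        using degree_power_le[of "ffact_poly M" p] by (simp add: distrib_left)
      then show "degree (A \<circ>\<^sub>p [:1, 1:] * ffact_poly M ^ p) < (M + 1) * (p + d)"
        using degree_mult_le[of "A \<circ>\<^sub>p [:1, 1:]" "ffact_poly M ^ p"] degree_A
        by (simp add: degree_pcompose)
    qed
    ultimately have deg: "degree (lhs - rhs) < (M + 1) * (p + d)" by (rule degree_diff_less)
    have "real ` {M..<M + M + k} \<subseteq> {x. poly (lhs - rhs) x = 0}" using roots by blast
    then have "card (real ` {M..<M + M + k}) \<le> card {x. poly (lhs - rhs) x = 0}"
      by (intro card_mono poly_roots_finite nz)
    also have "\<dots> \<le> degree (lhs - rhs)" by (rule card_poly_roots_bound[OF nz])
    finally have "M + k \<le> degree (lhs - rhs)" by (simp add: card_image)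
    then show False using deg M(2) by (simp add: k_def)
  qed
  then show ?thesis
    using shift_equation_imp_zero[of Q M p "1 / z" "p + d" A] z_nz d_pos degree_A
    by (simp add: lhs_def rhs_def)
qed

end

section \<open>From rational relations to linear independence\<close>

lemma common_denominator:
  fixes S :: "real set"
  assumes "finite S" "S \<subseteq> \<rat>"
  shows "\<exists>D::int. 0 < D \<and> (\<forall>x\<in>S. of_int D * x \<in> \<int>)"
  using assms
proof (induction S rule: finite_induct)
  case empty
  then show ?case by (intro exI[of _ 1]) simp
next
  case (insert x S)
  then obtain D :: int where D: "0 < D" "\<forall>x\<in>S. of_int D * x \<in> \<int>" by auto
  from insert.prems obtain a b where ab: "0 < b" "x = of_int a / of_int b"
    by (auto elim: Rats_cases')
  have "of_int (b * D) * y \<in> \<int>" if "y \<in> insert x S" for y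
  proof (cases "y = x")
    case True
    then have "of_int (b * D) * y = of_int (D * a)" using ab by simp
    then show ?thesis by (metis Ints_of_int)
  next
    case False
    then have "of_int D * y \<in> \<int>" using that D by simp
    then have "of_int b * (of_int D * y) \<in> \<int>" by (rule Ints_mult[OF Ints_of_int])
    then show ?thesis by (simp only: of_int_mult mult.assoc)
  qed
  then show ?case using ab(1) D(1) by (intro exI[of _ "b * D"]) auto
qed

text \<open>All \<open>j\<close> share the denominator
  \<open>Suc k ^ q = Suc k ^ p * Suc k ^ (q - p)\<close>, whose second factor completes
  \<open>fact k\<close> to \<open>fact (Suc k)\<close>.\<close>

lemma z_mult_hyp_term:
  assumes "p < q" "j \<le> q"
  shows "of_rat z * hyp_term p q z j k
    = real (Suc k) ^ (q - j) / real (Suc k) ^ p * of_rat z ^ Suc k / fact (Suc k) ^ (q - p)"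
proof -
  have "real (Suc k) ^ (q - j) * real (Suc k) ^ j = real (Suc k) ^ p * real (Suc k) ^ (q - p)"
    using assms by (simp flip: power_add)
  then have e: "1 / real (Suc k) ^ j = real (Suc k) ^ (q - j) / (real (Suc k) ^ p * real (Suc k) ^ (q - p))"
    by (simp add: field_simps del: of_nat_Suc)
  have "of_rat z * hyp_term p q z j k = of_rat z ^ Suc k / fact k ^ (q - p) * (1 / real (Suc k) ^ j)"
    by (simp add: hyp_term_def)
  then show ?thesis unfolding e by (simp add: power_mult_distrib mult_ac del: of_nat_Suc)
qed

text \<open>The coefficients \<open>c j\<close> sit at distinct monomials of degree
  \<open>q - j < q\<close> in \<open>A\<close>, so \<open>A = 0\<close> removes them all, and then
  \<open>c0\<close> as well.\<close>

lemma hyp_const_relation_trivial: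
  fixes c :: "nat \<Rightarrow> rat"
  assumes "p < q" "z \<noteq> 0"
    and rel: "of_rat c0 + (\<Sum>j=1..q. of_rat (c j) * hyp_const p q z j) = 0"
  shows "c0 = 0 \<and> (\<forall>j\<in>{1..q}. c j = 0)"
proof -
  define x :: real where "x = of_rat z"
  have x: "x \<noteq> 0" using assms(2) by (simp add: x_def)
  obtain a b where ab: "0 < b" "x = of_int a / of_int b"
    by (rule Rats_cases'[of x]) (auto simp: x_def)
  have a: "a \<noteq> 0" using ab x by auto
  \<comment> \<open>The relation gets multiplied by \<open>x\<close>, so it is \<open>x * c0\<close>
    whose denominator must be cleared.\<close>
  define S where "S = insert (x * of_rat c0) ((\<lambda>j. of_rat (c j)) ` {1..q})"
  have "finite S" "S \<subseteq> \<rat>" by (auto simp: S_def x_def)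
  from common_denominator[OF this]
  obtain D :: int where D: "0 < D" "\<And>y. y \<in> S \<Longrightarrow> of_int D * y \<in> \<int>" by metis
  define A where "A = (\<Sum>j=1..q. monom (of_int D * of_rat (c j) :: real) (q - j))"
  define \<gamma> where "\<gamma> = of_int D * (x * of_rat c0)"
  interpret vanishing_series p "q - p" x \<gamma> a A
  proof
    show "0 < q - p" "x \<noteq> 0" "a \<noteq> 0" using assms x a by auto
    show "of_int a / x \<in> \<int>" using ab a by simp
    show "\<gamma> \<in> \<int>" unfolding \<gamma>_def by (rule D) (simp add: S_def)
    show "poly A (real n) \<in> \<int>" for n
      unfolding A_def poly_sum poly_monom by (intro Ints_sum Ints_mult[OF D(2)] Ints_power) (auto simp: S_def)
    show "degree A < p + (q - p)"
      unfolding A_def using assms(1)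
      by (intro degree_sum_less) (auto intro: le_less_trans[OF degree_monom_le])
    have "(\<lambda>k. \<Sum>j=1..q. of_int D * of_rat (c j) * (x * hyp_term p q z j k))
        sums (\<Sum>j=1..q. of_int D * of_rat (c j) * (x * hyp_const p q z j))"
      unfolding hyp_const_def
      by (intro sums_sum sums_mult summable_sums summable_hyp_term assms(1))
    also have "(\<lambda>k. \<Sum>j=1..q. of_int D * of_rat (c j) * (x * hyp_term p q z j k))
      = (\<lambda>n. poly A (real (Suc n)) / real (Suc n) ^ p * x ^ Suc n / fact (Suc n) ^ (q - p))"
      unfolding A_def poly_sum poly_monom sum_divide_distrib sum_distrib_right x_def
      by (intro ext sum.cong refl, subst z_mult_hyp_term) (use assms(1) in \<open>auto simp del: of_nat_Suc fact_Suc\<close>)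
    also have "(\<Sum>j=1..q. of_int D * of_rat (c j) * (x * hyp_const p q z j))
        = of_int D * x * (\<Sum>j=1..q. of_rat (c j) * hyp_const p q z j)"
      by (simp add: sum_distrib_left mult_ac)
    also have "\<dots> = - \<gamma>" using rel by (simp add: \<gamma>_def add_eq_0_iff2)
    finally show "(\<lambda>n. poly A (real (Suc n)) / real (Suc n) ^ p * x ^ Suc n / fact (Suc n) ^ (q - p))
        sums - \<gamma>" .
  qed
  have c: "c j = 0" if j: "j \<in> {1..q}" for j
  proof -
    have "coeff A (q - j) = (\<Sum>i=1..q. if i = j then of_int D * of_rat (c i) else 0)"
      unfolding A_def coeff_sum coeff_monom using j by (intro sum.cong) auto
    also have "\<dots> = of_int D * of_rat (c j)" using j by (simp add: sum.delta)
    finally show ?thesis using poly_eq_0 D(1) by simp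
  qed
  then show ?thesis using rel by simp
qed

theorem theorem5p10:
  fixes p q :: nat and z :: rat
  assumes "p < q" and "z \<noteq> 0"
  shows "inj_on (hyp_const p q z) {1..q} \<and> 1 \<notin> hyp_const p q z ` {1..q} \<and>
         rat_vs.independent (insert 1 (hyp_const p q z ` {1..q})) \<and>
         (\<forall>j\<in>{1..q}. hyp_const p q z j \<notin> \<rat>)"
proof -
  define h where "h = hyp_const p q z"
  note rel = hyp_const_relation_trivial[OF assms, folded h_def]
  \<comment> \<open>Independence of a set ignores repetitions; injectivity and \<open>1\<close>
    lying outside the image make it a statement about the family.\<close>
  have inj: "inj_on h {1..q}"
  proof (rule inj_onI, rule ccontr)
    fix i j assume ij: "i \<in> {1..q}" "j \<in> {1..q}" "h i = h j" "i \<noteq> j"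
    define c :: "nat \<Rightarrow> rat" where "c k = (if k = i then 1 else 0) - (if k = j then 1 else 0)" for k
    have "(\<Sum>k=1..q. of_rat (c k) * h k)
        = (\<Sum>k=1..q. (if k = i then h k else 0) - (if k = j then h k else 0))"
      by (intro sum.cong) (auto simp: c_def of_rat_minus)
    also have "\<dots> = 0" using ij by (simp add: sum_subtractf sum.delta)
    finally have "c i = 0" using rel[of 0 c] ij by simp
    then show False using ij by (simp add: c_def)
  qed
  have irr: "h j \<notin> \<rat>" if j: "j \<in> {1..q}" for j
  proof
    assume "h j \<in> \<rat>"
    then obtain r where r: "h j = of_rat r" by (auto elim: Rats_cases)
    have "(\<Sum>k=1..q. of_rat (if k = j then 1 else 0) * h k) = (\<Sum>k=1..q. if k = j then h k else 0)"
      by (intro sum.cong) auto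
    also have "\<dots> = h j" using j by (simp add: sum.delta)
    finally have "of_rat (- r) + (\<Sum>k=1..q. of_rat (if k = j then 1 else 0) * h k) = 0"
      by (simp only: r of_rat_minus)
    from conjunct2[OF rel[OF this]] j show False by force
  qed
  \<comment> \<open>A value 1 would be rational.\<close>
  then have one: "1 \<notin> h ` {1..q}" by (metis Rats_1 imageE)
  have "rat_vs.independent (insert 1 (h ` {1..q}))"
  proof
    assume "rat_vs.dependent (insert 1 (h ` {1..q}))"
    then obtain u v where u: "v \<in> insert 1 (h ` {1..q})" "u v \<noteq> 0"
        "(\<Sum>v\<in>insert 1 (h ` {1..q}). rat_scale (u v) v) = 0"
      by (auto simp: rat_vs.dependent_finite)
    have "(\<Sum>v\<in>insert 1 (h ` {1..q}). rat_scale (u v) v)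
        = of_rat (u 1) + (\<Sum>j=1..q. of_rat (u (h j)) * h j)"
      using one by (simp add: sum.reindex[OF inj[unfolded One_nat_def]] rat_scale_def)
    with u(3) have "u 1 = 0 \<and> (\<forall>j\<in>{1..q}. u (h j) = 0)"
      using rel[of "u 1" "\<lambda>j. u (h j)"] by simp
    with u(1,2) show False by auto
  qed
  then show ?thesis using inj one irr by (simp add: h_def)
qed

end
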